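(* Let $(C,\phi,F)$ be a semicoherent $n$-component system with $C=\{1,\ldots,n\}$ whose component lifetimes $T_1,\ldots,T_n$ have no ties. For every nonempty set $M\subseteq C$ with $m=|M|$ and every $k\in\{1,\ldots,m\}$, the probability $p_M^{(k)}=\Pr(T_C=T_{k:M})$ satisfies $$ p_M^{(k)} = \sum_{A\subseteq C,\ |M\cap A|=m-k+1} q_M^{\downarrow}(A)\,\phi(A)-\sum_{A\subseteq C,\ |M\cap A|=m-k} q_M^{\uparrow}(A)\,\phi(A). $$
   Context: $C=\{1,\ldots,n\}$ is the set of components. $T_1,\ldots,T_n$ are nonnegative real random variables on a common probability space (the component lifetimes), with joint c.d.f. $F$, and there are no ties: $\Pr(T_i=T_j)=0$ for all distinct $i,j\in C$. No independence is assumed. The structure function $\phi\colon\{0,1\}^n\to\{0,1\}$ is identified with a set function $\phi\colon 2^C\to\{0,1\}$ (identify $(x_1,\ldots,x_n)$ with $A=\{i: x_i=1\}$). The system is semicoherent: $\phi$ is nondecreasing in each variable, $\phi(\varnothing)=0$ and $\phi(C)=1$. The system lifetime is $T_C=\max_{A\subseteq C,\ \phi(A)=1}\min_{i\in A}T_i$. For nonempty $M\subseteq C$ with $m=|M|$, $T_{k:M}$ is the $k$th smallest of the variables $T_i$, $i\in M$ ($k$th order statistic). For $j\in C$ and $A\subseteq C\setminus\{j\}$: $q_j(A)=\Pr\big(\max_{i\in C\setminus A}T_i=T_j<\min_{i\in A}T_i\big)$. The minimum over the empty set is $+\infty$ and the maximum over the empty set is $-\infty$. The functions $q_M^{\downarrow}\colon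 2^C\setminus\{\varnothing\}\to\mathbb{R}$ and $q_M^{\uparrow}\colon 2^C\setminus\{C\}\to\mathbb{R}$ are defined by $$q_M^{\downarrow}(A)=\sum_{j\in M\cap A}q_j(A\setminus\{j\})=\Pr\Big(\exists\, j\in M:\ \max_{i\in C\setminus A}T_i<T_j=\min_{i\in A}T_i\Big),$$ $$q_M^{\uparrow}(A)=\sum_{j\in M\setminus A}q_j(A)=\Pr\Big(\exists\, j\in M:\ \max_{i\in C\setminus A}T_i=T_j<\min_{i\in A}T_i\Big).$$ *)

theory Defs
  imports "HOL-Probability.Probability" "HOL-Library.Multiset"
begin

text \<open>
  A structure function is given as a set function on the subsets of the set \<open>C\<close> of components:
  a state vector in \<open>{0,1}^C\<close> is identified with the set of components in state 1.
\<close>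

definition semicoherent :: "'c set \<Rightarrow> ('c set \<Rightarrow> nat) \<Rightarrow> bool" where
  "semicoherent C \<phi> \<longleftrightarrow>
     (\<forall>A\<subseteq>C. \<phi> A \<in> {0, 1}) \<and>
     (\<forall>A\<subseteq>C. \<forall>j\<in>C. \<phi> (A - {j}) \<le> \<phi> (insert j A)) \<and>
     \<phi> {} = 0 \<and> \<phi> C = 1"

definition no_ties :: "'w measure \<Rightarrow> 'c set \<Rightarrow> ('c \<Rightarrow> 'w \<Rightarrow> real) \<Rightarrow> bool" where
  "no_ties P C T \<longleftrightarrow>
     (\<forall>i\<in>C. \<forall>j\<in>C. i \<noteq> j \<longrightarrow> measure P {\<omega> \<in> space P. T i \<omega> = T j \<omega>} = 0)"

text \<open>
  For finite \<open>C\<close> and semicoherent \<open>\<phi>\<close>, the outer maximum is over a finite nonempty family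
  of nonempty sets, so that all values of \<^const>\<open>Max\<close> and \<^const>\<open>Min\<close> are meaningful.
\<close>

definition system_lifetime ::
    "'c set \<Rightarrow> ('c set \<Rightarrow> nat) \<Rightarrow> ('c \<Rightarrow> 'w \<Rightarrow> real) \<Rightarrow> 'w \<Rightarrow> real" where
  "system_lifetime C \<phi> T \<omega> =
     Max ((\<lambda>A. Min ((\<lambda>i. T i \<omega>) ` A)) ` {A. A \<subseteq> C \<and> \<phi> A = 1})"

text \<open>
  The \<open>k\<close>-th smallest, \<open>1 \<le> k \<le> card M\<close>, of the values \<open>T i \<omega>\<close> with \<open>i \<in> M\<close>, counted with
  multiplicity (list positions start at 0).
\<close>

definition order_statistic ::
    "nat \<Rightarrow> 'c set \<Rightarrow> ('c \<Rightarrow> 'w \<Rightarrow> real) \<Rightarrow> 'w \<Rightarrow> real" where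
  "order_statistic k M T \<omega> =
     sorted_list_of_multiset (image_mset (\<lambda>i. T i \<omega>) (mset_set M)) ! (k - 1)"

text \<open>
  Over finite index sets, \<open>SUP\<close> and \<open>INF\<close> in \<^typ>\<open>ereal\<close> are the maximum and the minimum,
  with values \<open>-\<infinity>\<close> and \<open>\<infinity>\<close> on the empty set.
\<close>

definition q ::
    "'w measure \<Rightarrow> 'c set \<Rightarrow> ('c \<Rightarrow> 'w \<Rightarrow> real) \<Rightarrow> 'c \<Rightarrow> 'c set \<Rightarrow> real" where
  "q P C T j A = measure P {\<omega> \<in> space P.
     (SUP i\<in>C - A. ereal (T i \<omega>)) = ereal (T j \<omega>) \<and>
     ereal (T j \<omega>) < (INF i\<in>A. ereal (T i \<omega>))}"

definition q_down ::
    "'w measure \<Rightarrow> 'c set \<Rightarrow> ('c \<Rightarrow> 'w \<Rightarrow> real) \<Rightarrow> 'c set \<Rightarrow> 'c set \<Rightarrow> real" where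
  "q_down P C T M A = (\<Sum>j\<in>M \<inter> A. q P C T j (A - {j}))"

definition q_up ::
    "'w measure \<Rightarrow> 'c set \<Rightarrow> ('c \<Rightarrow> 'w \<Rightarrow> real) \<Rightarrow> 'c set \<Rightarrow> 'c set \<Rightarrow> real" where
  "q_up P C T M A = (\<Sum>j\<in>M - A. q P C T j A)"

end

theory Submission
  imports Defs
begin

text \<open>
  Fix an outcome without ties. If component \<open>j\<close> fails at time \<open>T j\<close>, let \<open>B\<close> be the set of
  components that outlive it. The system is alive up to \<open>T j\<close> iff \<open>\<phi> (insert j B) = 1\<close> and
  alive beyond \<open>T j\<close> iff \<open>\<phi> B = 1\<close>, so \<open>\<phi> (insert j B) - \<phi> B\<close> is the indicator of the event
  that the system dies exactly with \<open>j\<close>. Moreover \<open>T j\<close> is the \<open>k\<close>-th smallest lifetime in \<open>M\<close>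
  for exactly one \<open>j \<in> M\<close>, namely the one that is outlived by \<open>m - k\<close> elements of \<open>M\<close>. Hence
  the indicator of \<open>T\<^sub>C = T\<^sub>k\<^sub>:\<^sub>M\<close> is almost surely the sum of \<open>\<phi> (insert j B) - \<phi> B\<close>, over all
  \<open>j \<in> M\<close> and all \<open>B\<close> that contain \<open>m - k\<close> elements of \<open>M\<close> but not \<open>j\<close>, each term being
  multiplied by the indicator of the event that \<open>B\<close> is the set of components outliving \<open>j\<close>
  (\<open>indicator_system_dies_at_order_statistic\<close>).

  That last event is the one whose probability is \<open>q\<^sub>j(B)\<close> (\<open>q_eq_measure_outliving\<close>), so
  taking expectations expresses the probability by the differences \<open>q\<^sub>j(B) (\<phi> (insert j B) - \<phi> B)\<close>.
  Collecting the terms with \<open>\<phi> (insert j B)\<close> by the set \<open>A = insert j B\<close>, and those with \<open>\<phi> B\<close>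
  by \<open>A = B\<close>, produces the two sums over \<open>q_down\<close> and \<open>q_up\<close>.
\<close>

definition outliving :: "'c set \<Rightarrow> ('c \<Rightarrow> 'w \<Rightarrow> real) \<Rightarrow> 'c \<Rightarrow> 'w \<Rightarrow> 'c set" where
  "outliving C T j \<omega> = {i \<in> C. T j \<omega> < T i \<omega>}"

lemma outliving_subset: "outliving C T j \<omega> \<subseteq> C - {j}"
  by (auto simp: outliving_def)

section \<open>The system lifetime\<close>

lemma semicoherent_mono:
  assumes sc: "semicoherent C \<phi>" and "finite C" "A \<subseteq> B" "B \<subseteq> C"
  shows "\<phi> A \<le> \<phi> B"
proof -
  have "finite (B - A)" using assms finite_subset by blast
  moreover have "D \<subseteq> C - A \<Longrightarrow> \<phi> A \<le> \<phi> (A \<union> D)" if "finite D" for D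
    using that
  proof (induction D)
    case (insert x D)
    have "A \<union> D \<subseteq> C" "x \<in> C" using insert.prems assms(3,4) by auto
    then have "\<phi> ((A \<union> D) - {x}) \<le> \<phi> (insert x (A \<union> D))"
      using sc unfolding semicoherent_def by blast
    moreover have "(A \<union> D) - {x} = A \<union> D" using insert by auto
    ultimately show ?case using insert by auto
  qed simp
  ultimately have "\<phi> A \<le> \<phi> (A \<union> (B - A))" using assms(4) by blast
  moreover have "A \<union> (B - A) = B" using assms(3) by auto
  ultimately show ?thesis by simp
qed

text \<open>
  Stated for an arbitrary upward closed set \<open>X\<close> of times, so as to cover both \<open>{v..}\<close> and
  \<open>{v<..}\<close>: the largest minimum lies in \<open>X\<close> iff some working set has all its lifetimes in \<open>X\<close>,
  and by monotonicity that set may be replaced by the largest possible one.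
\<close>

lemma system_lifetime_in_upset_iff:
  assumes sc: "semicoherent C \<phi>" and fin: "finite C"
    and up: "\<And>x y. x \<in> X \<Longrightarrow> x \<le> y \<Longrightarrow> y \<in> X"
  shows "system_lifetime C \<phi> T \<omega> \<in> X \<longleftrightarrow> \<phi> {i \<in> C. T i \<omega> \<in> X} = 1"
proof -
  let ?F = "{A. A \<subseteq> C \<and> \<phi> A = 1}"
  let ?mn = "\<lambda>A. Min ((\<lambda>i. T i \<omega>) ` A)"
  have F: "finite ?F" "?F \<noteq> {}"
    using fin sc unfolding semicoherent_def by auto
  have ne: "finite A \<and> A \<noteq> {}" if "A \<in> ?F" for A
    using that sc fin finite_subset unfolding semicoherent_def by fastforce
  have Min_up: "?mn A \<in> X \<longleftrightarrow> (\<forall>i\<in>A. T i \<omega> \<in> X)" if "A \<in> ?F" for A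
  proof
    assume "?mn A \<in> X"
    then show "\<forall>i\<in>A. T i \<omega> \<in> X" using up ne[OF that] by (meson Min_le finite_imageI imageI)
  next
    assume "\<forall>i\<in>A. T i \<omega> \<in> X"
    moreover have "?mn A \<in> (\<lambda>i. T i \<omega>) ` A" using ne[OF that] by (intro Min_in) auto
    ultimately show "?mn A \<in> X" by auto
  qed
  have "system_lifetime C \<phi> T \<omega> \<in> X \<longleftrightarrow> (\<exists>A\<in>?F. ?mn A \<in> X)"
  proof
    have "system_lifetime C \<phi> T \<omega> \<in> ?mn ` ?F"
      unfolding system_lifetime_def using F by (intro Max_in) auto
    then show "system_lifetime C \<phi> T \<omega> \<in> X \<Longrightarrow> \<exists>A\<in>?F. ?mn A \<in> X" by auto
  next
    assume "\<exists>A\<in>?F. ?mn A \<in> X"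
    then obtain A where "A \<in> ?F" "?mn A \<in> X" by blast
    moreover from this have "?mn A \<le> system_lifetime C \<phi> T \<omega>"
      unfolding system_lifetime_def using F by (intro Max_ge) auto
    ultimately show "system_lifetime C \<phi> T \<omega> \<in> X" using up by blast
  qed
  also have "\<dots> \<longleftrightarrow> (\<exists>A\<in>?F. A \<subseteq> {i \<in> C. T i \<omega> \<in> X})"
    using Min_up by auto
  also have "\<dots> \<longleftrightarrow> \<phi> {i \<in> C. T i \<omega> \<in> X} = 1"
  proof
    assume "\<exists>A\<in>?F. A \<subseteq> {i \<in> C. T i \<omega> \<in> X}"
    then obtain A where "A \<in> ?F" "A \<subseteq> {i \<in> C. T i \<omega> \<in> X}" by blast
    then have "1 \<le> \<phi> {i \<in> C. T i \<omega> \<in> X}"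
      using semicoherent_mono[OF sc fin, of A "{i \<in> C. T i \<omega> \<in> X}"] by auto
    moreover have "\<phi> {i \<in> C. T i \<omega> \<in> X} \<in> {0, 1}"
      using sc unfolding semicoherent_def by auto
    ultimately show "\<phi> {i \<in> C. T i \<omega> \<in> X} = 1" by auto
  next
    assume "\<phi> {i \<in> C. T i \<omega> \<in> X} = 1"
    then have "{i \<in> C. T i \<omega> \<in> X} \<in> ?F" by simp
    then show "\<exists>A\<in>?F. A \<subseteq> {i \<in> C. T i \<omega> \<in> X}" by blast
  qed
  finally show ?thesis .
qed

text \<open>
  Lifetime at least \<open>T j\<close> and lifetime more than \<open>T j\<close> are decided by the state of the system
  just before and just after the failure of \<open>j\<close>. By monotonicity the difference of the two
  states is never negative, hence an indicator.
\<close>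

lemma indicator_system_dies_with:
  assumes sc: "semicoherent C \<phi>" and fin: "finite C" and j: "j \<in> C"
    and inj: "inj_on (\<lambda>i. T i \<omega>) C"
  shows "of_bool (system_lifetime C \<phi> T \<omega> = T j \<omega>)
       = real (\<phi> (insert j (outliving C T j \<omega>))) - real (\<phi> (outliving C T j \<omega>))"
proof -
  let ?L = "system_lifetime C \<phi> T \<omega>" and ?B = "outliving C T j \<omega>"
  have j_notin: "j \<notin> ?B" and B_sub: "?B \<subseteq> C" by (auto simp: outliving_def)
  have inj': "T j \<omega> \<le> T i \<omega> \<longleftrightarrow> i = j \<or> T j \<omega> < T i \<omega>" if "i \<in> C" for i
  proof -
    have "T i \<omega> = T j \<omega> \<longleftrightarrow> i = j" using inj_on_eq_iff[where f = "\<lambda>i. T i \<omega>", OF inj that j] .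
    then show ?thesis by (metis order_le_less)
  qed
  \<comment> \<open>without ties, \<open>j\<close> is the only component failing at time \<open>T j \<omega>\<close>\<close>
  have ins: "{i \<in> C. T i \<omega> \<in> {T j \<omega>..}} = insert j ?B"
  proof (rule set_eqI)
    fix i show "i \<in> {i \<in> C. T i \<omega> \<in> {T j \<omega>..}} \<longleftrightarrow> i \<in> insert j ?B"
      using inj'[of i] j by (cases "i \<in> C") (auto simp: outliving_def)
  qed
  have B: "{i \<in> C. T i \<omega> \<in> {T j \<omega><..}} = ?B"
    by (auto simp: outliving_def)
  have 1: "T j \<omega> \<le> ?L \<longleftrightarrow> \<phi> (insert j ?B) = 1"
    using system_lifetime_in_upset_iff[OF sc fin, of "{T j \<omega>..}" T \<omega>]
    unfolding ins by simp
  have 2: "T j \<omega> < ?L \<longleftrightarrow> \<phi> ?B = 1"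
    using system_lifetime_in_upset_iff[OF sc fin, of "{T j \<omega><..}" T \<omega>]
    unfolding B by simp
  have ins_sub: "insert j ?B \<subseteq> C" using j B_sub by simp
  from sc have "\<forall>A\<subseteq>C. \<phi> A \<in> {0, 1}" unfolding semicoherent_def by (elim conjE)
  then have 3: "\<phi> ?B = 0 \<or> \<phi> ?B = 1" "\<phi> (insert j ?B) = 0 \<or> \<phi> (insert j ?B) = 1"
    using B_sub ins_sub by simp_all
  have 4: "\<phi> ?B \<le> \<phi> (insert j ?B)"
    by (rule semicoherent_mono[OF sc fin subset_insertI ins_sub])
  have "?L = T j \<omega> \<longleftrightarrow> \<phi> (insert j ?B) = 1 \<and> \<phi> ?B \<noteq> 1"
    unfolding 1[symmetric] 2[symmetric] by linarith
  then show ?thesis using 3 4 by (elim disjE) simp_all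
qed

section \<open>Order statistics\<close>

text \<open>
  In a sorted list the entries below \<open>v\<close> form an initial segment, and so do the entries up to
  \<open>v\<close>; position \<open>r\<close> carries \<open>v\<close> iff it lies in the second segment but not in the first.
\<close>

lemma sorted_nth_eq_iff:
  fixes v :: "'a::linorder"
  assumes "sorted xs" "r < length xs"
  shows "xs ! r = v \<longleftrightarrow> length (filter (\<lambda>x. x < v) xs) \<le> r \<and> r < length (filter (\<lambda>x. x \<le> v) xs)"
proof -
  have seg: "r < length (filter Q xs) \<longleftrightarrow> Q (xs ! r)"
    if down: "\<And>x y. Q y \<Longrightarrow> x \<le> y \<Longrightarrow> Q x" for Q
    using assms
  proof (induction xs arbitrary: r)
    case (Cons a xs)
    show ?case
    proof (cases "Q a")
      case True
      then show ?thesis using Cons by (cases r) auto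
    next
      case False
      then have none: "\<not> Q x" if "x \<in> set (a # xs)" for x
        using that down Cons.prems(1) by auto
      then have "filter Q (a # xs) = []" by (simp add: filter_empty_conv)
      moreover have "\<not> Q ((a # xs) ! r)" using none Cons.prems(2) nth_mem by blast
      ultimately show ?thesis by simp
    qed
  qed simp
  have "r < length (filter (\<lambda>x. x < v) xs) \<longleftrightarrow> xs ! r < v"
    by (rule seg) auto
  moreover have "r < length (filter (\<lambda>x. x \<le> v) xs) \<longleftrightarrow> xs ! r \<le> v"
    by (rule seg) auto
  ultimately show ?thesis by auto
qed

lemma length_filter_sorted_values:
  assumes "finite M"
  shows "length (filter Q (sorted_list_of_multiset (image_mset f (mset_set M)))) = card {i \<in> M. Q (f i)}"
proof -
  have "length (filter Q (sorted_list_of_multiset (image_mset f (mset_set M))))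
      = size (filter_mset Q (image_mset f (mset_set M)))"
    by (metis mset_filter mset_sorted_list_of_multiset size_mset)
  also have "\<dots> = card {i \<in> M. Q (f i)}"
    using assms by (simp add: filter_mset_image_mset filter_mset_mset_set)
  finally show ?thesis .
qed

text \<open>
  The two counts describe order statistics at every outcome, ties included. Hence events that
  involve them are measurable as they stand, and not merely up to a null set.
\<close>

lemma order_statistic_eq_iff:
  assumes "finite M" "k \<in> {1..card M}"
  shows "order_statistic k M T \<omega> = v
    \<longleftrightarrow> card {i \<in> M. T i \<omega> < v} < k \<and> k \<le> card {i \<in> M. T i \<omega> \<le> v}"
proof -
  let ?xs = "sorted_list_of_multiset (image_mset (\<lambda>i. T i \<omega>) (mset_set M))"
  have "length ?xs = card M"
    using length_filter_sorted_values[OF assms(1), of "\<lambda>_. True"] by simp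
  then show ?thesis
    unfolding order_statistic_def
    using sorted_nth_eq_iff[of ?xs "k - 1" v] assms(2)
    unfolding length_filter_sorted_values[OF assms(1)]
    by (simp, linarith)
qed

lemma order_statistic_attained:
  assumes "finite M" "k \<in> {1..card M}"
  obtains j where "j \<in> M" "order_statistic k M T \<omega> = T j \<omega>"
proof -
  let ?xs = "sorted_list_of_multiset (image_mset (\<lambda>i. T i \<omega>) (mset_set M))"
  have "length ?xs = card M"
    using length_filter_sorted_values[OF assms(1), of "\<lambda>_. True"] by simp
  then have "order_statistic k M T \<omega> \<in> set ?xs"
    unfolding order_statistic_def using assms by (intro nth_mem) auto
  then show ?thesis using assms that by auto
qed

text \<open>
  Without ties, \<open>T j\<close> is the \<open>k\<close>-th smallest value iff exactly \<open>k\<close> values in \<open>M\<close>, its own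
  included, are at most \<open>T j\<close>; the other \<open>card M - k\<close> belong to components outliving \<open>j\<close>.
\<close>

lemma order_statistic_eq_iff_card_outliving:
  assumes fin: "finite C" and M: "M \<subseteq> C" and k: "k \<in> {1..card M}" and j: "j \<in> M"
    and inj: "inj_on (\<lambda>i. T i \<omega>) C"
  shows "order_statistic k M T \<omega> = T j \<omega> \<longleftrightarrow> card (M \<inter> outliving C T j \<omega>) = card M - k"
proof -
  have finM: "finite M" using fin M finite_subset by blast
  let ?lt = "{i \<in> M. T i \<omega> < T j \<omega>}" and ?le = "{i \<in> M. T i \<omega> \<le> T j \<omega>}"
  have "?le = insert j ?lt"
    using inj j M by (auto simp: inj_on_def order_le_less)
  then have 1: "card ?le = Suc (card ?lt)" using finM by simp
  have "M = ?le \<union> (M \<inter> outliving C T j \<omega>)" "?le \<inter> (M \<inter> outliving C T j \<omega>) = {}"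
    using M by (auto simp: outliving_def)
  then have "card M = card ?le + card (M \<inter> outliving C T j \<omega>)"
    using finM card_Un_disjoint by (metis finite_Un)
  then show ?thesis
    using order_statistic_eq_iff[OF finM k, of T \<omega> "T j \<omega>"] 1 k by auto
qed

section \<open>The pointwise identity\<close>

text \<open>
  The double sum has at most one nonzero term: the restriction on \<open>card (M \<inter> B)\<close> singles out
  the component \<open>j0\<close> that realizes the order statistic, and the factor \<open>of_bool\<close> singles out
  the set of components outliving it. Keeping \<open>B\<close> as a summation index, instead of inserting
  this random set, leaves coefficients that are constant when expectations are taken.
\<close>

lemma indicator_system_dies_at_order_statistic:
  assumes sc: "semicoherent C \<phi>" and fin: "finite C" and M: "M \<subseteq> C" and k: "k \<in> {1..card M}"
    and inj: "inj_on (\<lambda>i. T i \<omega>) C"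
  shows "of_bool (system_lifetime C \<phi> T \<omega> = order_statistic k M T \<omega>)
       = (\<Sum>j\<in>M. \<Sum>B | B \<subseteq> C - {j} \<and> card (M \<inter> B) = card M - k.
            of_bool (outliving C T j \<omega> = B) * (real (\<phi> (insert j B)) - real (\<phi> B)))"
proof -
  have finM: "finite M" using fin M finite_subset by blast
  obtain j0 where j0: "j0 \<in> M" "order_statistic k M T \<omega> = T j0 \<omega>"
    by (rule order_statistic_attained[where T = T and \<omega> = \<omega>, OF finM k])
  have unique: "card (M \<inter> outliving C T j \<omega>) = card M - k \<longleftrightarrow> j = j0" if "j \<in> M" for j
  proof -
    have "j0 \<in> C" "j \<in> C" using j0(1) that M by auto
    from inj_on_eq_iff[where f = "\<lambda>i. T i \<omega>", OF inj this]
    have "T j0 \<omega> = T j \<omega> \<longleftrightarrow> j = j0" by (metis (no_types))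
    with order_statistic_eq_iff_card_outliving[where T = T and \<omega> = \<omega>, OF fin M k that inj] show ?thesis
      unfolding j0(2) by simp
  qed
  let ?I = "\<lambda>j. {B. B \<subseteq> C - {j} \<and> card (M \<inter> B) = card M - k}"
  let ?c = "\<lambda>j B. real (\<phi> (insert j B)) - real (\<phi> B)"
  have inner: "(\<Sum>B\<in>?I j. of_bool (outliving C T j \<omega> = B) * ?c j B)
      = (if j = j0 then ?c j (outliving C T j \<omega>) else 0)" if "j \<in> M" for j
  proof -
    have fin_I: "finite (?I j)" using fin by simp
    have "(\<Sum>B\<in>?I j. of_bool (outliving C T j \<omega> = B) * ?c j B)
        = (\<Sum>B\<in>?I j. if outliving C T j \<omega> = B then ?c j B else 0)"
      by (rule sum.cong[OF refl]) auto
    also have "\<dots> = (if outliving C T j \<omega> \<in> ?I j then ?c j (outliving C T j \<omega>) else 0)"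
      by (rule sum.delta'[OF fin_I])
    finally have "(\<Sum>B\<in>?I j. of_bool (outliving C T j \<omega> = B) * ?c j B)
        = (if outliving C T j \<omega> \<in> ?I j then ?c j (outliving C T j \<omega>) else 0)" .
    moreover have "outliving C T j \<omega> \<in> ?I j \<longleftrightarrow> j = j0"
      using unique[OF that] outliving_subset[of C T j \<omega>] by simp
    ultimately show ?thesis by (simp only:)
  qed
  have "(\<Sum>j\<in>M. \<Sum>B\<in>?I j. of_bool (outliving C T j \<omega> = B) * ?c j B)
      = (\<Sum>j\<in>M. if j = j0 then ?c j (outliving C T j \<omega>) else 0)"
    by (rule sum.cong[OF refl inner])
  also have "\<dots> = ?c j0 (outliving C T j0 \<omega>)"
    using sum.delta[OF finM, of j0 "\<lambda>j. ?c j (outliving C T j \<omega>)"] j0(1) by (simp only: if_True)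
  also have "\<dots> = of_bool (system_lifetime C \<phi> T \<omega> = order_statistic k M T \<omega>)"
    unfolding j0(2)
    using indicator_system_dies_with[where T = T and \<omega> = \<omega> and j = j0, OF sc fin _ inj] j0(1) M
    by (simp add: subsetD)
  finally show ?thesis by (rule sym)
qed

section \<open>Probabilities\<close>

lemma less_INF_finite_iff:
  fixes f :: "'c \<Rightarrow> ereal"
  assumes "finite A" "x < \<infinity>"
  shows "x < (INF i\<in>A. f i) \<longleftrightarrow> (\<forall>i\<in>A. x < f i)"
  using assms by (induction A) (simp_all add: top_ereal_def inf_min)

text \<open>
  Since \<open>j\<close> itself lies in \<open>C - A\<close>, the supremum is automatically at least \<open>T j\<close>; so the event
  says that the components of \<open>A\<close>, and no others, fail after \<open>j\<close>.
\<close>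

lemma q_eq_measure_outliving:
  assumes fin: "finite C" and j: "j \<in> C" and A: "A \<subseteq> C - {j}"
  shows "q P C T j A = measure P {\<omega> \<in> space P. outliving C T j \<omega> = A}"
proof -
  have "(SUP i\<in>C - A. ereal (T i \<omega>)) = ereal (T j \<omega>) \<and> ereal (T j \<omega>) < (INF i\<in>A. ereal (T i \<omega>))
      \<longleftrightarrow> outliving C T j \<omega> = A" for \<omega>
  proof -
    have "(SUP i\<in>C - A. ereal (T i \<omega>)) = ereal (T j \<omega>) \<longleftrightarrow> (\<forall>i\<in>C - A. T i \<omega> \<le> T j \<omega>)"
    proof
      assume "(SUP i\<in>C - A. ereal (T i \<omega>)) = ereal (T j \<omega>)"
      then show "\<forall>i\<in>C - A. T i \<omega> \<le> T j \<omega>" by (metis SUP_upper ereal_less_eq(3))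
    next
      assume "\<forall>i\<in>C - A. T i \<omega> \<le> T j \<omega>"
      then show "(SUP i\<in>C - A. ereal (T i \<omega>)) = ereal (T j \<omega>)"
        using j A by (intro antisym SUP_least SUP_upper) auto
    qed
    moreover have "ereal (T j \<omega>) < (INF i\<in>A. ereal (T i \<omega>)) \<longleftrightarrow> (\<forall>i\<in>A. T j \<omega> < T i \<omega>)"
      using A fin by (subst less_INF_finite_iff) (auto intro: finite_subset)
    ultimately show ?thesis
      using A by (auto simp: outliving_def not_le[symmetric])
  qed
  then show ?thesis unfolding q_def by simp
qed

lemma AE_no_ties_inj_on:
  assumes "prob_space P" "finite C" and "no_ties P C T"
    and [measurable]: "\<And>i. i \<in> C \<Longrightarrow> T i \<in> borel_measurable P"
  shows "AE \<omega> in P. inj_on (\<lambda>i. T i \<omega>) C"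
proof -
  interpret prob_space P by fact
  have "AE \<omega> in P. T i \<omega> \<noteq> T j \<omega>" if [measurable]: "i \<in> C" "j \<in> C" and "i \<noteq> j" for i j
  proof (rule AE_I')
    have "{\<omega> \<in> space P. T i \<omega> = T j \<omega>} \<in> sets P" by measurable
    moreover have "measure P {\<omega> \<in> space P. T i \<omega> = T j \<omega>} = 0"
      using assms(3) that unfolding no_ties_def by blast
    ultimately show "{\<omega> \<in> space P. T i \<omega> = T j \<omega>} \<in> null_sets P"
      by (auto simp: null_sets_def emeasure_eq_measure)
  qed auto
  then have "AE \<omega> in P. \<forall>i\<in>C. \<forall>j\<in>C. i \<noteq> j \<longrightarrow> T i \<omega> \<noteq> T j \<omega>"
    using \<open>finite C\<close> by (intro AE_finite_allI) auto
  then show ?thesis by (auto simp: inj_on_def elim!: eventually_mono)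
qed

lemma system_lifetime_measurable:
  assumes sc: "semicoherent C \<phi>" and fin: "finite C"
    and meas: "\<And>i. i \<in> C \<Longrightarrow> T i \<in> borel_measurable P"
  shows "system_lifetime C \<phi> T \<in> borel_measurable P"
proof -
  have "(\<lambda>\<omega>. Min ((\<lambda>i. T i \<omega>) ` A)) \<in> borel_measurable P" if "A \<subseteq> C" for A
    using that fin meas by (intro borel_measurable_Min) (auto intro: finite_subset)
  then show ?thesis
    unfolding system_lifetime_def[abs_def] using fin
    by (intro borel_measurable_Max) auto
qed

lemma outliving_event_measurable:
  assumes fin: "finite C" and j: "j \<in> C"
    and meas: "\<And>i. i \<in> C \<Longrightarrow> T i \<in> borel_measurable P"
  shows "{\<omega> \<in> space P. outliving C T j \<omega> = B} \<in> sets P"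
proof (cases "B \<subseteq> C")
  case True
  note [measurable] = meas[OF j]
  have "{\<omega> \<in> space P. outliving C T j \<omega> = B}
      = {\<omega> \<in> space P. \<forall>i\<in>C. T j \<omega> < T i \<omega> \<longleftrightarrow> i \<in> B}"
    using True by (auto simp: outliving_def)
  also have "\<dots> \<in> sets P"
  proof (rule sets.sets_Collect_finite_All[OF _ fin])
    fix i assume "i \<in> C"
    note [measurable] = meas[OF this]
    show "{\<omega> \<in> space P. T j \<omega> < T i \<omega> \<longleftrightarrow> i \<in> B} \<in> sets P" by measurable
  qed
  finally show ?thesis .
next
  case False
  then have "{\<omega> \<in> space P. outliving C T j \<omega> = B} = {}"
    by (auto simp: outliving_def)
  then show ?thesis by (simp only: sets.empty_sets)
qed

lemma system_dies_at_order_statistic_measurable: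
  assumes sc: "semicoherent C \<phi>" and fin: "finite C" and M: "M \<subseteq> C" and k: "k \<in> {1..card M}"
    and meas: "\<And>i. i \<in> C \<Longrightarrow> T i \<in> borel_measurable P"
  shows "{\<omega> \<in> space P. system_lifetime C \<phi> T \<omega> = order_statistic k M T \<omega>} \<in> sets P"
proof -
  have finM: "finite M" using fin M finite_subset by blast
  have [measurable]: "system_lifetime C \<phi> T \<in> borel_measurable P"
    using system_lifetime_measurable[OF sc fin meas] .
  have [measurable]: "T i \<in> borel_measurable P" if "i \<in> M" for i
    using meas M that by blast
  let ?L = "system_lifetime C \<phi> T"
  \<comment> \<open>a random cardinality is measurable because it is a finite sum of indicators\<close>
  have card_sum: "real (card {i \<in> M. Q i}) = (\<Sum>i\<in>M. if Q i then 1 else 0)" for Q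
    using finM by (simp add: sum.If_cases Int_def)
  have "?L \<omega> = order_statistic k M T \<omega>
      \<longleftrightarrow> (\<Sum>i\<in>M. if T i \<omega> < ?L \<omega> then 1 else 0) < real k
        \<and> real k \<le> (\<Sum>i\<in>M. if T i \<omega> \<le> ?L \<omega> then 1 else 0)" for \<omega>
    unfolding card_sum[symmetric] of_nat_less_iff of_nat_le_iff eq_commute[of "?L \<omega>"]
    by (rule order_statistic_eq_iff[OF finM k])
  then have "{\<omega> \<in> space P. ?L \<omega> = order_statistic k M T \<omega>}
      = {\<omega> \<in> space P. (\<Sum>i\<in>M. if T i \<omega> < ?L \<omega> then 1 else 0) < real k
        \<and> real k \<le> (\<Sum>i\<in>M. if T i \<omega> \<le> ?L \<omega> then 1 else 0)}"
    by (simp only:)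
  also have "\<dots> \<in> sets P" by measurable
  finally show ?thesis .
qed

text \<open>
  This is obtained by integrating the pointwise identity, whose hypothesis of distinct lifetimes
  is satisfied almost surely.
\<close>

lemma prob_system_dies_at_order_statistic:
  assumes P: "prob_space P" and sc: "semicoherent C \<phi>" and fin: "finite C" and M: "M \<subseteq> C"
    and k: "k \<in> {1..card M}"
    and meas: "\<And>i. i \<in> C \<Longrightarrow> T i \<in> borel_measurable P" and nt: "no_ties P C T"
  shows "measure P {\<omega> \<in> space P. system_lifetime C \<phi> T \<omega> = order_statistic k M T \<omega>}
       = (\<Sum>j\<in>M. \<Sum>B | B \<subseteq> C - {j} \<and> card (M \<inter> B) = card M - k.
            q P C T j B * (real (\<phi> (insert j B)) - real (\<phi> B)))"
proof -
  interpret prob_space P by (rule P)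
  let ?E = "{\<omega> \<in> space P. system_lifetime C \<phi> T \<omega> = order_statistic k M T \<omega>}"
  let ?D = "\<lambda>j B. {\<omega> \<in> space P. outliving C T j \<omega> = B}"
  let ?I = "\<lambda>j. {B. B \<subseteq> C - {j} \<and> card (M \<inter> B) = card M - k}"
  let ?c = "\<lambda>j B. real (\<phi> (insert j B)) - real (\<phi> B)"
  have E: "?E \<in> sets P"
    by (rule system_dies_at_order_statistic_measurable[OF sc fin M k meas])
  have D: "?D j B \<in> sets P" if "j \<in> M" for j B
    using that M by (intro outliving_event_measurable fin meas) auto
  have int: "integrable P (\<lambda>\<omega>. indicat_real (?D j B) \<omega> * ?c j B)" if "j \<in> M" for j B
    by (intro integrable_mult_left integrable_real_indicator D that) (simp add: emeasure_eq_measure)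
  have inj: "AE \<omega> in P. inj_on (\<lambda>i. T i \<omega>) C"
    by (rule AE_no_ties_inj_on[OF P fin nt meas])
  have "measure P ?E = (\<integral>\<omega>. indicat_real ?E \<omega> \<partial>P)"
    using E by simp
  also have "\<dots> = (\<integral>\<omega>. (\<Sum>j\<in>M. \<Sum>B\<in>?I j. indicat_real (?D j B) \<omega> * ?c j B) \<partial>P)"
  proof (rule integral_cong_AE)
    show "indicat_real ?E \<in> borel_measurable P"
      using E by (rule borel_measurable_indicator)
    show "(\<lambda>\<omega>. \<Sum>j\<in>M. \<Sum>B\<in>?I j. indicat_real (?D j B) \<omega> * ?c j B) \<in> borel_measurable P"
      by (intro borel_measurable_sum borel_measurable_integrable int)
    show "AE \<omega> in P. indicat_real ?E \<omega> = (\<Sum>j\<in>M. \<Sum>B\<in>?I j. indicat_real (?D j B) \<omega> * ?c j B)"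
      using inj AE_space
    proof eventually_elim
      case (elim \<omega>)
      have ind: "indicat_real {\<omega> \<in> space P. Q \<omega>} \<omega> = of_bool (Q \<omega>)" for Q
        using elim(2) by (simp add: indicator_def)
      show ?case
        unfolding ind
        by (rule indicator_system_dies_at_order_statistic[where T = T and \<omega> = \<omega>, OF sc fin M k elim(1)])
    qed
  qed
  also have "\<dots> = (\<Sum>j\<in>M. \<integral>\<omega>. (\<Sum>B\<in>?I j. indicat_real (?D j B) \<omega> * ?c j B) \<partial>P)"
    by (rule Bochner_Integration.integral_sum) (intro Bochner_Integration.integrable_sum int)
  also have "\<dots> = (\<Sum>j\<in>M. \<Sum>B\<in>?I j. q P C T j B * ?c j B)"
  proof (rule sum.cong[OF refl])
    fix j assume j: "j \<in> M"
    have "(\<integral>\<omega>. (\<Sum>B\<in>?I j. indicat_real (?D j B) \<omega> * ?c j B) \<partial>P)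
        = (\<Sum>B\<in>?I j. \<integral>\<omega>. indicat_real (?D j B) \<omega> * ?c j B \<partial>P)"
      by (rule Bochner_Integration.integral_sum) (rule int[OF j])
    also have "\<dots> = (\<Sum>B\<in>?I j. q P C T j B * ?c j B)"
    proof (rule sum.cong[OF refl])
      fix B assume "B \<in> ?I j"
      then have "q P C T j B = measure P (?D j B)"
        using j M by (intro q_eq_measure_outliving fin) auto
      moreover have "(\<integral>\<omega>. indicat_real (?D j B) \<omega> \<partial>P) = measure P (?D j B)"
        using D[OF j, of B] by simp
      ultimately show "(\<integral>\<omega>. indicat_real (?D j B) \<omega> * ?c j B \<partial>P) = q P C T j B * ?c j B"
        by (simp only: integral_mult_left_zero)
    qed
    finally show "(\<integral>\<omega>. (\<Sum>B\<in>?I j. indicat_real (?D j B) \<omega> * ?c j B) \<partial>P)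
        = (\<Sum>B\<in>?I j. q P C T j B * ?c j B)" .
  qed
  finally show ?thesis .
qed

section \<open>Collecting terms by the state of the system\<close>

lemma sum_q_up_eq:
  assumes fin: "finite C" and M: "M \<subseteq> C"
  shows "(\<Sum>A | A \<subseteq> C \<and> card (M \<inter> A) = r. q_up P C T M A * real (\<phi> A))
       = (\<Sum>j\<in>M. \<Sum>B | B \<subseteq> C - {j} \<and> card (M \<inter> B) = r. q P C T j B * real (\<phi> B))"
proof -
  have finM: "finite M" using fin M finite_subset by blast
  let ?S = "{A. A \<subseteq> C \<and> card (M \<inter> A) = r}"
  have "(\<Sum>A\<in>?S. q_up P C T M A * real (\<phi> A))
      = (\<Sum>A\<in>?S. \<Sum>j | j \<in> M \<and> j \<notin> A. q P C T j A * real (\<phi> A))"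
    by (simp add: q_up_def sum_distrib_right set_diff_eq)
  also have "\<dots> = (\<Sum>j\<in>M. \<Sum>A | A \<in> ?S \<and> j \<notin> A. q P C T j A * real (\<phi> A))"
    using fin finM by (intro sum.swap_restrict) auto
  also have "\<dots> = (\<Sum>j\<in>M. \<Sum>B | B \<subseteq> C - {j} \<and> card (M \<inter> B) = r. q P C T j B * real (\<phi> B))"
    by (intro sum.cong refl) auto
  finally show ?thesis .
qed

text \<open>
  Here the sum runs over \<open>A = insert j B\<close>. As \<open>j\<close> belongs to \<open>M\<close> but not to \<open>B\<close>, the set \<open>A\<close>
  has one more element of \<open>M\<close> than \<open>B\<close>, whence the shift by one in the cardinality.
\<close>

lemma sum_q_down_eq:
  assumes fin: "finite C" and M: "M \<subseteq> C"
  shows "(\<Sum>A | A \<subseteq> C \<and> card (M \<inter> A) = r + 1. q_down P C T M A * real (\<phi> A))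
       = (\<Sum>j\<in>M. \<Sum>B | B \<subseteq> C - {j} \<and> card (M \<inter> B) = r. q P C T j B * real (\<phi> (insert j B)))"
proof -
  have finM: "finite M" using fin M finite_subset by blast
  let ?S = "{A. A \<subseteq> C \<and> card (M \<inter> A) = r + 1}"
  have "(\<Sum>A\<in>?S. q_down P C T M A * real (\<phi> A))
      = (\<Sum>A\<in>?S. \<Sum>j | j \<in> M \<and> j \<in> A. q P C T j (A - {j}) * real (\<phi> A))"
    by (simp add: q_down_def sum_distrib_right Int_def)
  also have "\<dots> = (\<Sum>j\<in>M. \<Sum>A | A \<in> ?S \<and> j \<in> A. q P C T j (A - {j}) * real (\<phi> A))"
    using fin finM by (intro sum.swap_restrict) auto
  also have "\<dots> = (\<Sum>j\<in>M. \<Sum>B | B \<subseteq> C - {j} \<and> card (M \<inter> B) = r. q P C T j B * real (\<phi> (insert j B)))"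
  proof (rule sum.cong[OF refl])
    fix j assume j: "j \<in> M"
    have card_remove: "card (M \<inter> (A - {j})) = r" if "card (M \<inter> A) = r + 1" "j \<in> A" for A
    proof -
      have "M \<inter> (A - {j}) = (M \<inter> A) - {j}" by auto
      then show ?thesis using that j finM by simp
    qed
    have card_add: "card (M \<inter> insert j B) = r + 1" if "card (M \<inter> B) = r" "j \<notin> B" for B
      using that j finM by simp
    show "(\<Sum>A | A \<in> ?S \<and> j \<in> A. q P C T j (A - {j}) * real (\<phi> A))
        = (\<Sum>B | B \<subseteq> C - {j} \<and> card (M \<inter> B) = r. q P C T j B * real (\<phi> (insert j B)))"
    proof (rule sum.reindex_bij_witness[of _ "insert j" "\<lambda>A. A - {j}"])
      fix A assume A: "A \<in> {A. A \<in> ?S \<and> j \<in> A}"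
      then show "insert j (A - {j}) = A" by auto
      then show "q P C T j (A - {j}) * real (\<phi> (insert j (A - {j}))) = q P C T j (A - {j}) * real (\<phi> A)"
        by simp
      show "A - {j} \<in> {B. B \<subseteq> C - {j} \<and> card (M \<inter> B) = r}"
        using A card_remove[of A] by auto
    next
      fix B assume B: "B \<in> {B. B \<subseteq> C - {j} \<and> card (M \<inter> B) = r}"
      then have "j \<notin> B" by auto
      then show "insert j B - {j} = B" by simp
      show "insert j B \<in> {A. A \<in> ?S \<and> j \<in> A}"
        using B j M card_add[OF _ \<open>j \<notin> B\<close>] by auto
    qed
  qed
  finally show ?thesis .
qed

theorem corollary6:
  fixes P :: "'w measure" and n :: nat and C :: "nat set"
    and \<phi> :: "nat set \<Rightarrow> nat" and T :: "nat \<Rightarrow> 'w \<Rightarrow> real"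
    and M :: "nat set" and m k :: nat
  assumes "prob_space P"
    and "C = {1..n}"
    and "semicoherent C \<phi>"
    and "\<And>i. i \<in> C \<Longrightarrow> T i \<in> borel_measurable P"
    and "\<And>i \<omega>. i \<in> C \<Longrightarrow> \<omega> \<in> space P \<Longrightarrow> 0 \<le> T i \<omega>"
    and "no_ties P C T"
    and "M \<subseteq> C" and "M \<noteq> {}" and "m = card M"
    and "k \<in> {1..m}"
  shows "measure P {\<omega> \<in> space P. system_lifetime C \<phi> T \<omega> = order_statistic k M T \<omega>}
       = (\<Sum>A | A \<subseteq> C \<and> card (M \<inter> A) = m - k + 1. q_down P C T M A * real (\<phi> A))
       - (\<Sum>A | A \<subseteq> C \<and> card (M \<inter> A) = m - k. q_up P C T M A * real (\<phi> A))"
proof -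
  have fin: "finite C" using assms(2) by simp
  have k: "k \<in> {1..card M}" using assms by simp
  have "measure P {\<omega> \<in> space P. system_lifetime C \<phi> T \<omega> = order_statistic k M T \<omega>}
      = (\<Sum>j\<in>M. \<Sum>B | B \<subseteq> C - {j} \<and> card (M \<inter> B) = m - k.
            q P C T j B * (real (\<phi> (insert j B)) - real (\<phi> B)))"
    unfolding assms(9)
    by (rule prob_system_dies_at_order_statistic[OF assms(1,3) fin assms(7) k assms(4,6)])
  then show ?thesis
    unfolding sum_q_down_eq[OF fin assms(7)] sum_q_up_eq[OF fin assms(7)]
    by (simp only: right_diff_distrib sum_subtractf)
qed

end
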